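(* Let $\varrho$ be an aperiodic, primitive, bijective substitution of constant length $L$ with $\varrho_0=\mathrm{id}$, whose column group is Abelian, and let $v$ be a fixed point of $\varrho$. Let $N$ be the least $n$ such that for every letter $a$ the word $\varrho^n(a)$ contains all legal words of length $2$. Let $L=p_1^{n_1}p_2^{n_2}\cdots p_t^{n_t}$ be the prime factorisation of $L$ with $p_1<p_2<\cdots<p_t$ and assume $n_1\leqslant n_2\leqslant\cdots\leqslant n_t$. Then, for each $d\geqslant 1$ there exists $M\geqslant 1$ with $d\leqslant L^M$ such that $\gcd(d,L^{N+M})=\gcd(d,L^M)$. Moreover, for each $d\geqslant 1$, $$A_v(d)\leqslant L^{N+1}d^{B},\qquad\text{where } B=\frac{\log L}{n_1\log p_1}.$$ In particular, if $t=1$ (that is, $L$ is a power of a prime), then $A_v(d)\lesssim L^{N+1}d$.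
   Context: $\mathbb{N}=\mathbb{Z}_{\geqslant 0}$. A substitution on a finite alphabet $\mathcal{A}$ is a map $\varrho\colon\mathcal{A}\to\mathcal{A}^+$, extended to words by concatenation. It has constant length $L$ if $|\varrho(a)|=L$ for all $a$; its $i$-th column ($0\leqslant i\leqslant L-1$) is the map $\varrho_i\colon\mathcal{A}\to\mathcal{A}$ sending $a$ to the $i$-th letter of $\varrho(a)$ (indices from $0$). It is bijective if every column is a bijection. It is primitive if some power $\varrho^n$ is such that every $\varrho^n(a)$ contains all letters. A fixed point is $v\in\mathcal{A}^{\mathbb{N}}$ with $\varrho(v)=v$; $\varrho$ is aperiodic if it has no fixed point of the form $u^\infty$ with $u$ a finite word. The column group is the subgroup of the symmetric group on $\mathcal{A}$ generated by $\varrho_0,\dots,\varrho_{L-1}$. A word is legal if it is a subword (consecutive block) of $\varrho^n(a)$ for some $n$ and some letter $a$. For $v\in\mathcal{A}^{\mathbb{N}}$ and $d\geqslant1$, $A_v(d)$ is the maximum (supremum, in $\mathbb{N}\cup\{\infty\}$) of all $m$ such that there is $k\in\mathbb{N}$ with $v_k=v_{k+dn}$ for all $0\leqslant n\leqslant m-1$. $f(d)\lesssim g(d)$ means there is a positive function $h$ with $f(d)\leqslant h(d)$ for all $d$ and $\lim_{d\to\infty}h(d)/g(d)=1$. *)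

theory Defs
  imports
    Complex_Main
    "HOL-Library.Stream"
    "HOL-Library.Sublist"
    "HOL-Library.Extended_Real"
    "HOL-Computational_Algebra.Primes"
    "HOL-Algebra.Bij"
    "HOL-Algebra.Generated_Groups"
begin

text \<open>The finite alphabet is a type of class \<open>finite\<close>; one-sided infinite words are streams.\<close>

definition substitution :: "('a \<Rightarrow> 'a list) \<Rightarrow> bool" where
  "substitution \<rho> \<longleftrightarrow> (\<forall>a. \<rho> a \<noteq> [])"

definition subst_word :: "('a \<Rightarrow> 'a list) \<Rightarrow> 'a list \<Rightarrow> 'a list" where
  "subst_word \<rho> w = concat (map \<rho> w)"

definition subst_power :: "('a \<Rightarrow> 'a list) \<Rightarrow> nat \<Rightarrow> 'a \<Rightarrow> 'a list" where
  "subst_power \<rho> n a = (subst_word \<rho> ^^ n) [a]"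

definition fixed_point :: "('a \<Rightarrow> 'a list) \<Rightarrow> 'a stream \<Rightarrow> bool" where
  "fixed_point \<rho> v \<longleftrightarrow> flat (smap \<rho> v) = v"

definition aperiodic :: "('a \<Rightarrow> 'a list) \<Rightarrow> bool" where
  "aperiodic \<rho> \<longleftrightarrow> \<not> (\<exists>u. u \<noteq> [] \<and> fixed_point \<rho> (cycle u))"

definition primitive :: "('a \<Rightarrow> 'a list) \<Rightarrow> bool" where
  "primitive \<rho> \<longleftrightarrow> (\<exists>n. \<forall>a. set (subst_power \<rho> n a) = UNIV)"

definition constant_length :: "('a \<Rightarrow> 'a list) \<Rightarrow> nat \<Rightarrow> bool" where
  "constant_length \<rho> L \<longleftrightarrow> (\<forall>a. length (\<rho> a) = L)"

definition column :: "('a \<Rightarrow> 'a list) \<Rightarrow> nat \<Rightarrow> 'a \<Rightarrow> 'a" where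
  "column \<rho> i a = \<rho> a ! i"

definition bijective :: "('a \<Rightarrow> 'a list) \<Rightarrow> nat \<Rightarrow> bool" where
  "bijective \<rho> L \<longleftrightarrow> (\<forall>i<L. bij (column \<rho> i))"

text \<open>\<open>subgroup_generated\<close> intersects its generators with the carrier, so this is the group generated by
  all columns only if they are bijections.\<close>

definition column_group :: "('a \<Rightarrow> 'a list) \<Rightarrow> nat \<Rightarrow> ('a \<Rightarrow> 'a) monoid" where
  "column_group \<rho> L = subgroup_generated (BijGroup UNIV) (column \<rho> ` {..<L})"

definition legal :: "('a \<Rightarrow> 'a list) \<Rightarrow> 'a list \<Rightarrow> bool" where
  "legal \<rho> w \<longleftrightarrow> (\<exists>n a. sublist w (subst_power \<rho> n a))"

definition longest_monochromatic_ap :: "'a stream \<Rightarrow> nat \<Rightarrow> enat" where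
  "longest_monochromatic_ap v d =
     Sup {enat m | m. \<exists>k. \<forall>n<m. v !! k = v !! (k + d * n)}"

text \<open>The functions compared are functions of a difference \<open>d \<ge> 1\<close>; their values at \<open>0\<close> are irrelevant.\<close>

definition asymp_bounded :: "(nat \<Rightarrow> ereal) \<Rightarrow> (nat \<Rightarrow> real) \<Rightarrow> bool" where
  "asymp_bounded f g \<longleftrightarrow>
     (\<exists>h :: nat \<Rightarrow> real. (\<forall>d\<ge>1. 0 < h d \<and> f d \<le> ereal (h d)) \<and>
        (\<lambda>d. h d / g d) \<longlonglongrightarrow> 1)"

end

theory Submission
  imports Defs "HOL-Number_Theory.Cong"
begin

text \<open>If a monochromatic progression of difference \<open>d\<close> has more than \<open>L ^ (N + M)\<close> terms, where
  \<open>d \<le> L ^ M\<close> and \<open>gcd d (L ^ (N + M)) = gcd d (L ^ M) = D\<close>, then its positions meet every residue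
  modulo \<open>L ^ (N + M)\<close> that agrees with its start modulo \<open>D\<close>. As \<open>D\<close> divides \<open>L ^ M\<close>, some offset
  \<open>r < L ^ M\<close> can be fixed such that the step \<open>d\<close> leads from offset \<open>r\<close> in the \<open>y\<close>-th block of length \<open>L ^ M\<close>
  to a fixed offset in the next block, for every \<open>y\<close>. Columns of powers of \<open>\<rho>\<close> commute and act transitively, so
  the two letters being equal relates columns \<open>y\<close> and \<open>y + 1\<close> of \<open>\<rho> ^ N\<close> by one permutation that is independent
  of \<open>y\<close>. By the choice of \<open>N\<close> this permutation maps \<open>v !! i\<close> to \<open>v !! (i + 1)\<close> for all \<open>i\<close>, so \<open>v\<close> is periodic.
  For the explicit bound let \<open>M\<close> be least with \<open>d \<le> (p\<^sub>1 ^ n\<^sub>1) ^ M\<close>: since \<open>p\<^sub>1 ^ n\<^sub>1\<close> is the least of the prime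
  powers in \<open>L\<close>, the condition on the gcd holds, and minimality gives \<open>L ^ (M - 1) \<le> d powr B\<close>.\<close>

section \<open>Columns of powers of a substitution\<close>

lemma subst_word_append: "subst_word \<rho> (u @ w) = subst_word \<rho> u @ subst_word \<rho> w"
  by (simp add: subst_word_def)

text \<open>Iterates respect concatenation, so the images of letters determine them;
  \<open>subst_power \<rho> n\<close> can thus be treated as a substitution in its own
  right.\<close>

lemma funpow_subst_word: "(subst_word \<rho> ^^ n) w = subst_word (subst_power \<rho> n) w"
proof (induction w)
  case Nil
  have "(subst_word \<rho> ^^ n) [] = []" by (induction n) (auto simp: subst_word_def)
  moreover have "subst_word (subst_power \<rho> n) [] = []" by (simp add: subst_word_def)
  ultimately show ?case by simp
next
  case (Cons a w)
  have app: "(subst_word \<rho> ^^ n) (u @ w) = (subst_word \<rho> ^^ n) u @ (subst_word \<rho> ^^ n) w" for u w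
    by (induction n) (auto simp: subst_word_append)
  have "(subst_word \<rho> ^^ n) (a # w) = subst_power \<rho> n a @ (subst_word \<rho> ^^ n) w"
    using app[of "[a]" w] by (simp add: subst_power_def)
  moreover have "subst_word (subst_power \<rho> n) (a # w) =
      subst_power \<rho> n a @ subst_word (subst_power \<rho> n) w"
    by (simp add: subst_word_def)
  ultimately show ?case using Cons by simp
qed

lemma subst_power_add:
  "subst_power \<rho> (m + n) a = subst_word (subst_power \<rho> m) (subst_power \<rho> n a)"
  by (simp add: subst_power_def funpow_add flip: funpow_subst_word)

lemma subst_power_0 [simp]: "subst_power \<rho> 0 a = [a]"
  by (simp add: subst_power_def)

lemma subst_power_1 [simp]: "subst_power \<rho> (Suc 0) a = \<rho> a"
  by (simp add: subst_power_def subst_word_def)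

lemma length_subst_word:
  assumes "constant_length \<rho> L"
  shows "length (subst_word \<rho> w) = L * length w"
  using assms by (induction w) (auto simp: subst_word_def constant_length_def)

lemma nth_subst_word:
  assumes "constant_length \<rho> L" "i < length w" "j < L"
  shows "subst_word \<rho> w ! (L * i + j) = column \<rho> j (w ! i)"
  using assms
proof (induction w arbitrary: i)
  case (Cons a w)
  then show ?case
    by (cases i) (auto simp: subst_word_def nth_append constant_length_def column_def)
qed simp

lemma constant_length_subst_power:
  assumes "constant_length \<rho> L"
  shows "constant_length (subst_power \<rho> n) (L ^ n)"
proof (induction n)
  case (Suc n)
  then show ?case
    using subst_power_add[of \<rho> 1 n] length_subst_word[of "subst_power \<rho> 1" L] assms
    by (simp add: constant_length_def)
qed (simp add: constant_length_def)

text \<open>Letter \<open>i\<close> of the inner word expands to the block starting at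
  \<open>L ^ m * i\<close>, so the high-order part of a position acts first.\<close>

lemma column_subst_power_add:
  assumes "constant_length \<rho> L" "i < L ^ n" "j < L ^ m"
  shows "column (subst_power \<rho> (m + n)) (L ^ m * i + j) =
    column (subst_power \<rho> m) j \<circ> column (subst_power \<rho> n) i"
proof
  fix a
  have "length (subst_power \<rho> n a) = L ^ n"
    using constant_length_subst_power[OF assms(1)] by (simp add: constant_length_def)
  then show "column (subst_power \<rho> (m + n)) (L ^ m * i + j) a =
      (column (subst_power \<rho> m) j \<circ> column (subst_power \<rho> n) i) a"
    using nth_subst_word[OF constant_length_subst_power[OF assms(1)], of i _ j m] assms
    by (simp add: subst_power_add column_def)
qed

lemma digit_bounds:
  fixes L n j :: nat
  assumes "j < L ^ Suc n"
  shows "j div L < L ^ n" "j mod L < L"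
proof -
  have "L > 0" using assms by (cases L) auto
  then show "j div L < L ^ n" "j mod L < L"
    using assms by (auto simp: less_mult_imp_div_less mult.commute)
qed

lemma column_subst_power_Suc:
  assumes "constant_length \<rho> L" "j < L ^ Suc n"
  shows "column (subst_power \<rho> (Suc n)) j =
    column \<rho> (j mod L) \<circ> column (subst_power \<rho> n) (j div L)"
proof -
  have "subst_power \<rho> 1 = \<rho>" by auto
  then show ?thesis
    using column_subst_power_add[OF assms(1), of "j div L" n "j mod L" 1] digit_bounds[OF assms(2)]
    by simp
qed

text \<open>The base-\<open>L\<close> digits of \<open>j\<close> write a column of a power as a
  composition of columns of \<open>\<rho>\<close>; bijectivity and commutation are inherited this
  way.\<close>

lemma column_subst_power_induct:
  assumes "constant_length \<rho> L" "j < L ^ n"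
    and "P id" "\<And>f i. P f \<Longrightarrow> i < L \<Longrightarrow> P (column \<rho> i \<circ> f)"
  shows "P (column (subst_power \<rho> n) j)"
  using assms(2)
proof (induction n arbitrary: j)
  case 0
  have "column (subst_power \<rho> 0) 0 = id" by (auto simp: column_def)
  with 0 show ?case using assms(3) by (metis less_one power_0)
next
  case (Suc n)
  show ?case
    unfolding column_subst_power_Suc[OF assms(1) Suc.prems]
    by (intro assms(4) Suc.IH digit_bounds[OF Suc.prems])
qed

lemma bij_column_subst_power:
  fixes \<rho> :: "'a \<Rightarrow> 'a list"
  assumes "constant_length \<rho> L" "bijective \<rho> L" "j < L ^ n"
  shows "bij (column (subst_power \<rho> n) j)"
  using assms(1,3)
proof (rule column_subst_power_induct)
  fix f :: "'a \<Rightarrow> 'a" and i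
  assume "bij f" "i < L"
  then show "bij (column \<rho> i \<circ> f)"
    using assms(2) by (intro bij_comp) (auto simp: bijective_def)
qed (rule bij_id)

lemma column_subst_power_commute:
  assumes "constant_length \<rho> L" "j < L ^ n"
    and "\<And>i. i < L \<Longrightarrow> f \<circ> column \<rho> i = column \<rho> i \<circ> f"
  shows "f \<circ> column (subst_power \<rho> n) j = column (subst_power \<rho> n) j \<circ> f"
  using assms(1,2)
proof (rule column_subst_power_induct)
  fix g i
  assume "f \<circ> g = g \<circ> f" "i < L"
  then show "f \<circ> (column \<rho> i \<circ> g) = column \<rho> i \<circ> g \<circ> f"
    using assms(3) by (simp add: fun_eq_iff)
qed simp

text \<open>Bijectivity puts the columns into the carrier of \<open>BijGroup UNIV\<close>, so
  \<open>subgroup_generated\<close> keeps all of them as generators.\<close>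

lemma columns_commute:
  assumes "bijective \<rho> L" "comm_group (column_group \<rho> L)" "i < L" "j < L"
  shows "column \<rho> i \<circ> column \<rho> j = column \<rho> j \<circ> column \<rho> i"
proof -
  interpret C: comm_group "column_group \<rho> L" by fact
  have Bij: "column \<rho> l \<in> Bij UNIV" if "l < L" for l
    using assms(1) that by (auto simp: bijective_def Bij_def)
  then have "column \<rho> l \<in> carrier (column_group \<rho> L)" if "l < L" for l
    unfolding column_group_def carrier_subgroup_generated
    by (intro generate.incl) (use that in \<open>auto simp: BijGroup_def\<close>)
  with C.m_comm have "column \<rho> i \<otimes>\<^bsub>column_group \<rho> L\<^esub> column \<rho> j =
      column \<rho> j \<otimes>\<^bsub>column_group \<rho> L\<^esub> column \<rho> i"
    using assms(3,4) by blast
  then show ?thesis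
    using Bij assms(3,4) by (simp add: column_group_def BijGroup_def compose_def comp_def restrict_UNIV)
qed

section \<open>Fixed points\<close>

lemma snth_flat:
  assumes "\<forall>xs\<in>sset s. length xs = L" "j < L"
  shows "flat s !! (L * i + j) = s !! i ! j"
  using assms
proof (induction i arbitrary: s)
  case 0
  then have len: "length (shd s) = L" by (simp add: shd_sset)
  then have "shd s \<noteq> []" using assms(2) by auto
  with len assms(2) show ?case by (simp add: flat_unfold shift_snth_less)
next
  case (Suc i)
  then have len: "length (shd s) = L" by (simp add: shd_sset)
  then have "shd s \<noteq> []" using assms(2) by auto
  moreover have "flat (stl s) !! (L * i + j) = stl s !! i ! j"
    using Suc by (meson stl_sset)
  ultimately show ?case using len by (simp add: flat_unfold shift_snth_ge)
qed

text \<open>Since \<open>v\<close> is its own image, a position can be resolved one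
  base-\<open>L\<close> digit at a time, lowest digit first.\<close>

lemma snth_fixed_point:
  assumes "constant_length \<rho> L" "fixed_point \<rho> v" "j < L ^ n"
  shows "v !! (L ^ n * i + j) = column (subst_power \<rho> n) j (v !! i)"
  using assms(3)
proof (induction n arbitrary: j)
  case 0
  then show ?case by (simp add: column_def)
next
  case (Suc n)
  note dig = digit_bounds[OF Suc.prems]
  have "v !! (L * k + l) = column \<rho> l (v !! k)" if "l < L" for k l
  proof -
    have "flat (smap \<rho> v) !! (L * k + l) = smap \<rho> v !! k ! l"
      by (rule snth_flat) (use assms(1) that in \<open>auto simp: constant_length_def stream.set_map\<close>)
    then show ?thesis using assms(2) by (simp add: fixed_point_def column_def)
  qed
  from this[OF dig(2), of "L ^ n * i + j div L"]
  have "v !! (L ^ Suc n * i + j) = column \<rho> (j mod L) (v !! (L ^ n * i + j div L))"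
    by (simp add: algebra_simps)
  then show ?case
    using Suc.IH[OF dig(1)] column_subst_power_Suc[OF assms(1) Suc.prems] by simp
qed

section \<open>Periodic streams\<close>

lemma periodic_stream_eq_cycle:
  assumes "0 < q" "\<And>i. v !! (i + q) = v !! i"
  shows "v = cycle (stake q v)"
proof -
  let ?u = "stake q v"
  have u: "?u \<noteq> []" using assms(1) by (cases q) auto
  have "v !! i = cycle ?u !! i" for i
  proof (induction i rule: less_induct)
    case (less i)
    have dec: "cycle ?u !! i = (?u @- cycle ?u) !! i"
      using cycle_decomp[OF u] by simp
    show ?case
    proof (cases "i < q")
      case True
      then show ?thesis using dec by (simp add: shift_snth_less)
    next
      case False
      then have "v !! (i - q) = v !! i" using assms(2)[of "i - q"] by simp
      then show ?thesis using dec less[of "i - q"] False assms(1) by (simp add: shift_snth_ge)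
    qed
  qed
  then show ?thesis by (metis smap_alt stream.map_ident)
qed

text \<open>Finiteness of the alphabet forces a repeated letter, which alone gives only eventual
  periodicity; injectivity of \<open>h\<close> moves the repetition back to position 0.\<close>

lemma orbit_stream_eq_cycle:
  fixes v :: "'a::finite stream"
  assumes "inj h" "\<And>i. v !! Suc i = h (v !! i)"
  shows "\<exists>u. u \<noteq> [] \<and> v = cycle u"
proof -
  have it: "v !! (i + k) = (h ^^ k) (v !! i)" for i k
    by (induction k) (simp_all add: assms(2) del: snth.simps)
  have "\<not> inj (snth v)"
    using finite_UNIV finite_subset[of "range (snth v)" UNIV] infinite_UNIV_nat
    by (metis finite_imageD subset_UNIV)
  then obtain i j where ij: "i < j" "v !! i = v !! j"
    unfolding inj_def by (metis linorder_neqE_nat)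
  define q where "q = j - i"
  have q: "0 < q" "j = i + q" using ij by (auto simp: q_def)
  have "(h ^^ i) (v !! 0) = (h ^^ i) (v !! q)"
    using ij(2) it[of 0 i] it[of q i] q by (simp add: add.commute)
  then have "v !! 0 = v !! q"
    using inj_fn[OF assms(1)] by (metis injD)
  then have "v !! (k + q) = v !! k" for k
    using it[of 0 k] it[of q k] by (simp add: add.commute)
  then have "v = cycle (stake q v)"
    by (intro periodic_stream_eq_cycle q)
  moreover have "stake q v \<noteq> []" using q(1) by (cases q) auto
  ultimately show ?thesis by blast
qed

section \<open>Legal words and the existence of \<open>N\<close>\<close>

lemma sublist_pair_iff:
  "sublist [a, b] w \<longleftrightarrow> (\<exists>y. Suc y < length w \<and> w ! y = a \<and> w ! Suc y = b)"
proof
  assume "sublist [a, b] w"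
  then obtain us ws where "w = us @ [a, b] @ ws" by (auto simp: sublist_def)
  then show "\<exists>y. Suc y < length w \<and> w ! y = a \<and> w ! Suc y = b"
    by (intro exI[of _ "length us"]) (auto simp: nth_append)
next
  assume "\<exists>y. Suc y < length w \<and> w ! y = a \<and> w ! Suc y = b"
  then obtain y where y: "Suc y < length w" "w ! y = a" "w ! Suc y = b" by blast
  then have "w = take y w @ [a, b] @ drop (Suc (Suc y)) w"
    by (metis Cons_nth_drop_Suc Suc_lessD append_Cons append_Nil append_take_drop_id)
  then show "sublist [a, b] w" by (metis sublist_appendI)
qed

text \<open>Prefixes of \<open>v\<close> are power images of \<open>v !! 0\<close>, and
  \<open>2 \<le> L\<close> makes the one of length \<open>L ^ Suc i\<close> reach past position
  \<open>Suc i\<close>.\<close>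

lemma legal_snth_pair:
  assumes "constant_length \<rho> L" "fixed_point \<rho> v" "2 \<le> L"
  shows "legal \<rho> [v !! i, v !! Suc i]"
proof -
  have *: "Suc i < L ^ Suc i"
    using power_gt_expt[of L "Suc i"] assms(3) by simp
  have "v !! j = subst_power \<rho> (Suc i) (v !! 0) ! j" if "j \<le> Suc i" for j
    using snth_fixed_point[OF assms(1,2), of j "Suc i" 0] * that
    by (simp add: column_def)
  moreover have "length (subst_power \<rho> (Suc i) (v !! 0)) = L ^ Suc i"
    using constant_length_subst_power[OF assms(1)] by (simp add: constant_length_def)
  ultimately have "sublist [v !! i, v !! Suc i] (subst_power \<rho> (Suc i) (v !! 0))"
    unfolding sublist_pair_iff using * by (metis le_refl le_SucI)
  then show ?thesis unfolding legal_def by blast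
qed

text \<open>Guarantees that the minimum defining \<open>N\<close> exists. Only finitely many words
  have length \<open>l\<close>, so one exponent \<open>K\<close> serves them all; primitivity then
  carries them into the image of every letter.\<close>

lemma legal_words_in_power:
  fixes \<rho> :: "'a::finite \<Rightarrow> 'a list"
  assumes "substitution \<rho>" "column \<rho> 0 = id" "primitive \<rho>"
  shows "\<exists>i. \<forall>a w. legal \<rho> w \<and> length w = l \<longrightarrow> sublist w (subst_power \<rho> i a)"
proof -
  have sub: "sublist (subst_power \<rho> k b) (subst_power \<rho> (k + m) a)"
    if "b \<in> set (subst_power \<rho> m a)" for k m a b
  proof -
    from split_list[OF that] obtain us ws where "subst_power \<rho> m a = us @ b # ws" by blast
    then have "subst_power \<rho> (k + m) a =
        subst_word (subst_power \<rho> k) us @ subst_power \<rho> k b @ subst_word (subst_power \<rho> k) ws"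
      by (simp add: subst_power_add) (simp add: subst_word_def)
    then show ?thesis by (metis sublist_appendI)
  qed
  \<comment> \<open>As column 0 is the identity, each letter survives in its own images; by
    \<open>sub\<close>, its image under one power is then a block of its image under any higher
    power.\<close>
  have self: "a \<in> set (subst_power \<rho> m a)" for m a
  proof (induction m)
    case (Suc m)
    have "\<rho> a ! 0 = a"
      using fun_cong[OF assms(2), of a] by (simp add: column_def)
    then have "a \<in> set (\<rho> a)"
      using assms(1) by (metis length_greater_0_conv nth_mem substitution_def)
    moreover have "set (\<rho> a) \<subseteq> set (subst_power \<rho> (1 + m) a)"
      using Suc unfolding subst_power_add by (force simp: subst_word_def)
    ultimately show ?case by auto
  qed simp
  obtain m where m: "\<And>a. set (subst_power \<rho> m a) = UNIV"
    using assms(3) unfolding primitive_def by blast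
  define S where "S = {w. legal \<rho> w \<and> length w = l}"
  have "finite S"
    by (rule finite_subset[OF _ finite_lists_length_eq[of UNIV l]]) (auto simp: S_def)
  have "\<forall>w\<in>S. \<exists>k b. sublist w (subst_power \<rho> k b)" by (auto simp: S_def legal_def)
  then obtain k b where kb: "\<And>w. w \<in> S \<Longrightarrow> sublist w (subst_power \<rho> (k w) (b w))" by metis
  define K where "K = Max (k ` S)"
  have "sublist w (subst_power \<rho> (K + m) a)" if "w \<in> S" for w a
  proof -
    have "k w \<le> K" using \<open>finite S\<close> that by (simp add: K_def)
    then have "sublist (subst_power \<rho> (k w) (b w)) (subst_power \<rho> K (b w))"
      using sub[OF self, of "k w" "b w" "K - k w"] by simp
    moreover have "sublist (subst_power \<rho> K (b w)) (subst_power \<rho> (K + m) a)"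
      by (rule sub) (simp add: m)
    ultimately show ?thesis using kb[OF that] by (meson sublist_order.order.trans)
  qed
  then show ?thesis unfolding S_def by blast
qed

text \<open>If \<open>L = 1\<close>, power images are single letters, so primitivity leaves a
  one-letter alphabet and \<open>v\<close> is constant.\<close>

lemma aperiodic_length_ge_2:
  fixes \<rho> :: "'a::finite \<Rightarrow> 'a list"
  assumes "substitution \<rho>" "constant_length \<rho> L" "aperiodic \<rho>" "column \<rho> 0 = id"
    "fixed_point \<rho> v" "primitive \<rho>"
  shows "2 \<le> L"
proof (rule ccontr)
  assume "\<not> 2 \<le> L"
  moreover have "L \<noteq> 0"
    using assms(1,2) by (auto simp: substitution_def constant_length_def)
  ultimately have "L = 1" by simp
  obtain m where m: "\<And>a. set (subst_power \<rho> m a) = UNIV"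
    using assms(6) unfolding primitive_def by blast
  have "card (set (subst_power \<rho> m undefined)) \<le> length (subst_power \<rho> m undefined)"
    by (rule card_length)
  then have "card (UNIV :: 'a set) \<le> 1"
    using constant_length_subst_power[OF assms(2), of m] m \<open>L = 1\<close>
    by (simp add: constant_length_def)
  then have "x = y" for x y :: 'a
    by (metis One_nat_def UNIV_I card_le_Suc0_iff_eq finite_UNIV)
  then have "v !! Suc i = id (v !! i)" for i by blast
  then obtain u where "u \<noteq> []" "v = cycle u"
    using orbit_stream_eq_cycle[of id v] by auto
  then show False using assms(3,5) unfolding aperiodic_def by blast
qed

section \<open>The bound on monochromatic progressions\<close>

text \<open>Bezout solves the congruence over the integers, where coefficients may be negative;
  reduction modulo \<open>Q\<close> then yields a natural index below \<open>Q\<close>.\<close>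

lemma progression_hits_residue:
  fixes k d Q s :: nat
  assumes "0 < Q" "[s = k] (mod gcd d Q)"
  shows "\<exists>i<Q. [k + d * i = s] (mod Q)"
proof -
  obtain x where x: "[int d * x = gcd (int d) (int Q)] (mod int Q)"
    using cong_solve_int by blast
  have "int (gcd d Q) dvd int s - int k"
    using assms(2) by (metis cong_iff_dvd_diff cong_int_iff)
  then obtain c where c: "int s - int k = gcd (int d) (int Q) * c"
    by (auto simp: dvd_def)
  define i where "i = nat ((x * c) mod int Q)"
  have i: "int i = (x * c) mod int Q" using assms(1) by (simp add: i_def)
  have "[int d * int i = int d * (x * c)] (mod int Q)"
    unfolding i by (intro cong_mult cong_refl) (simp add: cong_def)
  also have "int d * (x * c) = (int d * x) * c" by simp
  also have "[(int d * x) * c = gcd (int d) (int Q) * c] (mod int Q)"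
    by (intro cong_mult x cong_refl)
  finally have "[int d * int i = int s - int k] (mod int Q)" by (simp add: c)
  then have "[int k + int d * int i = int k + (int s - int k)] (mod int Q)"
    by (intro cong_add cong_refl)
  then have "[int (k + d * i) = int s] (mod int Q)" by simp
  then have "[k + d * i = s] (mod Q)" by (simp only: cong_int_iff)
  moreover have "i < Q" using assms(1) i by (metis of_nat_less_iff pos_mod_bound of_nat_0_less_iff)
  ultimately show ?thesis by blast
qed

text \<open>Here \<open>M\<close> is any exponent satisfying the size and gcd conditions; it is
  optimised only in the main theorem.\<close>

lemma monochromatic_ap_le:
  fixes \<rho> :: "'a::finite \<Rightarrow> 'a list"
  assumes subst: "substitution \<rho>" and cl: "constant_length \<rho> L" and ap: "aperiodic \<rho>"
    and prim: "primitive \<rho>" and bij: "bijective \<rho> L" and col0: "column \<rho> 0 = id"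
    and comm: "comm_group (column_group \<rho> L)" and fp: "fixed_point \<rho> v"
    and N: "\<And>a w. legal \<rho> w \<Longrightarrow> length w = 2 \<Longrightarrow> sublist w (subst_power \<rho> N a)"
    and d: "1 \<le> d" "d \<le> L ^ M" "gcd d (L ^ (N + M)) = gcd d (L ^ M)"
    and mono: "\<forall>n<m. v !! k = v !! (k + d * n)"
  shows "m \<le> L ^ (N + M)"
proof (rule ccontr)
  assume "\<not> m \<le> L ^ (N + M)"
  then have m: "L ^ (N + M) < m" by simp
  have L2: "2 \<le> L"
    using aperiodic_length_ge_2[OF subst cl ap col0 fp prim] .
  define C where "C n j = column (subst_power \<rho> n) j" for n j
  \<comment> \<open>The commutation lemma is used twice: to move a single column of
    \<open>\<rho>\<close> past \<open>C n i\<close>, then to move \<open>C n i\<close> past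
    \<open>C n' j\<close>.\<close>
  have C_commute: "C n i \<circ> C n' j = C n' j \<circ> C n i" if "i < L ^ n" "j < L ^ n'" for n n' i j
    unfolding C_def
  proof (rule column_subst_power_commute[OF cl that(2)])
    fix l assume "l < L"
    then show "column (subst_power \<rho> n) i \<circ> column \<rho> l = column \<rho> l \<circ> column (subst_power \<rho> n) i"
      using column_subst_power_commute[OF cl that(1), of "column \<rho> l"]
        columns_commute[OF bij comm] by simp
  qed
  have C_transitive: "\<exists>n j. j < L ^ n \<and> C n j a = b" for a b
  proof -
    obtain n where "set (subst_power \<rho> n a) = UNIV"
      using prim unfolding primitive_def by blast
    then have "b \<in> set (subst_power \<rho> n a)" by simp
    moreover have "length (subst_power \<rho> n a) = L ^ n"
      using constant_length_subst_power[OF cl] by (simp add: constant_length_def)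
    ultimately show ?thesis unfolding C_def column_def by (metis in_set_conv_nth)
  qed

  define D where "D = gcd d (L ^ M)"
  have D: "0 < D" "D \<le> d" "D dvd L ^ M"
    using d(1) by (auto simp: D_def intro: dvd_imp_le)
  \<comment> \<open>\<open>r\<close> represents \<open>k\<close> modulo \<open>D\<close> among the
    last \<open>D\<close> offsets of a block. Since \<open>D \<le> d \<le> L ^ M\<close>, a step
    \<open>d\<close> from there ends in the next block, at offset \<open>r'\<close>.\<close>
  define r where "r = L ^ M - D + k mod D"
  have "D \<le> L ^ M" using D d(2) by linarith
  moreover have "k mod D < D" using D by simp
  ultimately have r: "r < L ^ M" "L ^ M \<le> r + d"
    using D(2) by (auto simp: r_def)
  have r_cong: "[r = k] (mod D)"
  proof -
    have "[L ^ M - D + k mod D = 0 + k] (mod D)"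
      using D(3) by (intro cong_add) (auto simp: cong_0_iff cong_def)
    then show ?thesis by (simp add: r_def)
  qed
  define r' where "r' = r + d - L ^ M"
  have r': "r' < L ^ M" "r + d = L ^ M + r'" using r d(2) by (auto simp: r'_def)

  have rel: "C M r \<circ> C N y = C M r' \<circ> C N (Suc y)" if y: "Suc y < L ^ N" for y
  proof -
    have "[L ^ M * y + r = 0 + k] (mod D)"
      using D(3) r_cong by (intro cong_add) (auto simp: cong_0_iff)
    then have "[L ^ M * y + r = k] (mod gcd d (L ^ (N + M)))"
      by (simp add: d(3) D_def)
    moreover have "0 < L ^ (N + M)" using L2 by simp
    ultimately obtain i where i: "i < L ^ (N + M)"
      "[k + d * i = L ^ M * y + r] (mod L ^ (N + M))"
      using progression_hits_residue by blast
    have "L ^ M * y + r < L ^ M * Suc y" using r by simp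
    also have "\<dots> \<le> L ^ M * L ^ N" using y by (intro mult_le_mono2) simp
    finally have "L ^ M * y + r < L ^ (N + M)" by (simp add: power_add mult.commute)
    then have "(k + d * i) mod L ^ (N + M) = L ^ M * y + r"
      using i(2) by (simp add: cong_def)
    then obtain z where "k + d * i = L ^ (N + M) * z + (L ^ M * y + r)"
      by (metis mult_div_mod_eq)
    then have z: "k + d * i = L ^ M * (L ^ N * z + y) + r"
      "k + d * Suc i = L ^ M * (L ^ N * z + Suc y) + r'"
      using r'(2) by (auto simp: power_add algebra_simps)
    have v_eq: "v !! (L ^ M * (L ^ N * z + y') + s) = (C M s \<circ> C N y') (v !! z)"
      if "y' < L ^ N" "s < L ^ M" for y' s
      using that by (simp add: C_def snth_fixed_point[OF cl fp])
    \<comment> \<open>From \<open>i < L ^ (N + M) < m\<close> also \<open>Suc i < m\<close>; this is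
      where more than \<open>L ^ (N + M)\<close> terms are required.\<close>
    have "v !! (k + d * i) = v !! (k + d * Suc i)"
      using mono m i(1) by (metis Suc_leI le_less_trans less_trans)
    then have eq: "(C M r \<circ> C N y) (v !! z) = (C M r' \<circ> C N (Suc y)) (v !! z)"
      unfolding z using v_eq[of y r] v_eq[of "Suc y" r'] y r r' by simp
    \<comment> \<open>The equality is known only at the letter \<open>v !! z\<close>. Some column of
      a power maps this letter to any given \<open>a\<close>, and it commutes with both
      sides.\<close>
    show ?thesis
    proof
      fix a
      obtain n j where nj: "j < L ^ n" "C n j (v !! z) = a" using C_transitive by blast
      have "(C M s \<circ> C N y') a = C n j ((C M s \<circ> C N y') (v !! z))"
        if "y' < L ^ N" "s < L ^ M" for y' s
        using C_commute[OF that(1) nj(1)] C_commute[OF that(2) nj(1)] nj(2)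
        by (metis comp_apply)
      then show "(C M r \<circ> C N y) a = (C M r' \<circ> C N (Suc y)) a"
        using eq y r r' by simp
    qed
  qed

  have bij_C: "bij (C M r)" "bij (C M r')"
    using bij_column_subst_power[OF cl bij] r r' by (auto simp: C_def)
  \<comment> \<open>\<open>h\<close> does not involve \<open>y\<close>, so any \<open>y\<close> at
    which a pair occurs in the image of \<open>v !! 0\<close> yields the same map.\<close>
  define h where "h = inv_into UNIV (C M r') \<circ> C M r"
  have "inj h"
    unfolding h_def using bij_C by (intro bij_is_inj bij_comp bij_imp_bij_inv)
  moreover have "v !! Suc i = h (v !! i)" for i
  proof -
    have "sublist [v !! i, v !! Suc i] (subst_power \<rho> N (v !! 0))"
      using N[OF legal_snth_pair[OF cl fp L2]] by simp
    moreover have "length (subst_power \<rho> N (v !! 0)) = L ^ N"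
      using constant_length_subst_power[OF cl] by (simp add: constant_length_def)
    ultimately obtain y where "Suc y < L ^ N" "C N y (v !! 0) = v !! i"
      "C N (Suc y) (v !! 0) = v !! Suc i"
      unfolding sublist_pair_iff C_def column_def by auto
    then have "C M r (v !! i) = C M r' (v !! Suc i)"
      using rel by (metis comp_apply)
    then show ?thesis using bij_C(2) by (simp add: h_def bij_is_inj)
  qed
  ultimately obtain u where "u \<noteq> []" "v = cycle u"
    using orbit_stream_eq_cycle by blast
  then show False using ap fp unfolding aperiodic_def by blast
qed

text \<open>For a prime \<open>r\<close> of \<open>L\<close>, a power of \<open>r\<close> dividing
  \<open>d\<close> is at most \<open>q ^ M\<close>, hence at most
  \<open>r ^ (M * multiplicity r L)\<close>. So a higher power of \<open>L\<close> cannot enlarge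
  the gcd.\<close>

lemma gcd_power_stable:
  fixes d L q M N :: nat
  assumes "1 \<le> d" "d \<le> q ^ M" "0 < L"
    and q: "\<And>r. prime r \<Longrightarrow> r dvd L \<Longrightarrow> q \<le> r ^ multiplicity r L"
  shows "gcd d (L ^ (N + M)) = gcd d (L ^ M)"
proof (rule dvd_antisym)
  have "gcd d (L ^ (N + M)) dvd L ^ M"
  proof (rule multiplicity_le_imp_dvd)
    show "gcd d (L ^ (N + M)) \<noteq> 0" using assms(1) by auto
    fix r :: nat
    assume r: "prime r"
    let ?e = "multiplicity r (gcd d (L ^ (N + M)))"
    show "?e \<le> multiplicity r (L ^ M)"
    proof (cases "r dvd L")
      case True
      have "r ^ ?e dvd d" by (meson dvd_trans gcd_dvd1 multiplicity_dvd)
      then have "r ^ ?e \<le> d" using assms(1) by (intro dvd_imp_le) auto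
      also have "\<dots> \<le> (r ^ multiplicity r L) ^ M"
        using assms(2) power_mono[OF q[OF r True], of M] by simp
      also have "\<dots> = r ^ (M * multiplicity r L)"
        by (simp add: mult.commute flip: power_mult)
      finally have "?e \<le> M * multiplicity r L"
        using prime_gt_1_nat[OF r] by (metis power_le_imp_le_exp)
      then show ?thesis using r assms(3) by (simp add: prime_elem_multiplicity_power_distrib)
    next
      case False
      then have "\<not> r dvd gcd d (L ^ (N + M))"
        using r by (meson dvd_trans gcd_dvd2 prime_dvd_power)
      then show ?thesis by (simp add: not_dvd_imp_multiplicity_0)
    qed
  qed
  then show "gcd d (L ^ (N + M)) dvd gcd d (L ^ M)" by simp
  show "gcd d (L ^ M) dvd gcd d (L ^ (N + M))"
    by (simp add: power_add)
qed

theorem proposition27: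
  fixes \<rho> :: "'a::finite \<Rightarrow> 'a list"
    and v :: "'a stream"
    and L N t :: nat
    and p n :: "nat \<Rightarrow> nat"
    and B :: real
  assumes "substitution \<rho>"
    and "constant_length \<rho> L"
    and "aperiodic \<rho>"
    and "primitive \<rho>"
    and "bijective \<rho> L"
    and "column \<rho> 0 = id"
    and "comm_group (column_group \<rho> L)"
    and "fixed_point \<rho> v"
    and "N = (LEAST i. \<forall>a w. legal \<rho> w \<and> length w = 2 \<longrightarrow> sublist w (subst_power \<rho> i a))"
    and "\<forall>i\<in>{1..t}. prime (p i) \<and> 1 \<le> n i"
    and "L = (\<Prod>i=1..t. p i ^ n i)"
    and "strict_mono_on {1..t} p"
    and "mono_on {1..t} n"
    and "B = ln (real L) / (real (n 1) * ln (real (p 1)))"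
  shows "(\<forall>d\<ge>1. \<exists>M\<ge>1. d \<le> L ^ M \<and> gcd d (L ^ (N + M)) = gcd d (L ^ M)) \<and>
    (\<forall>d\<ge>1. ereal_of_enat (longest_monochromatic_ap v d)
              \<le> ereal (real L ^ (N + 1) * real d powr B)) \<and>
    (t = 1 \<longrightarrow>
       asymp_bounded (\<lambda>d. ereal_of_enat (longest_monochromatic_ap v d))
         (\<lambda>d. real L ^ (N + 1) * real d))"
proof -
  note subst = assms(1) and cl = assms(2) and ap = assms(3) and prim = assms(4) and bij = assms(5)
    and col0 = assms(6) and comm = assms(7) and fp = assms(8)
  have L2: "2 \<le> L"
    using aperiodic_length_ge_2[OF subst cl ap col0 fp prim] .
  have t: "1 \<le> t"
    using L2 assms(11) by (cases t) auto
  have p: "prime (p i)" "1 \<le> n i" if "i \<in> {1..t}" for i using assms(10) that by auto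
  define q where "q = p 1 ^ n 1"
  have "p 1 ^ 1 \<le> q"
    unfolding q_def using p[of 1] t prime_gt_0_nat by (intro power_increasing) (auto simp: Suc_le_eq)
  then have q2: "2 \<le> q" using prime_ge_2_nat[OF p(1), of 1] t by simp
  have "q dvd L"
    unfolding q_def assms(11) using t by (intro dvd_prodI) auto
  then have qL: "q \<le> L" using L2 by (intro dvd_imp_le) auto
  \<comment> \<open>Both orderings enter: base and exponent are smallest at index 1, so
    \<open>q\<close> is the least of the prime powers in \<open>L\<close>.\<close>
  have q_le: "q \<le> r ^ multiplicity r L" if r: "prime r" "r dvd L" for r
  proof -
    obtain i where i: "i \<in> {1..t}" "r dvd p i ^ n i"
      using r unfolding assms(11) by (auto simp: prime_dvd_prod_iff)
    then have "r = p i" using r p by (meson primes_dvd_imp_eq prime_dvd_power)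
    have "p i ^ n i dvd L"
      unfolding assms(11) using i by (intro dvd_prodI) auto
    then have "n i \<le> multiplicity r L"
      using r L2 \<open>r = p i\<close> by (intro multiplicity_geI) (auto simp: not_prime_unit)
    have "p 1 \<le> p i" "n 1 \<le> n i"
      using i(1) t strict_mono_on_imp_mono_on[OF assms(12)] assms(13)
      by (auto simp: monotone_on_def)
    then have "q \<le> r ^ n i"
      unfolding q_def \<open>r = p i\<close>
      by (metis le_trans p(1) i(1) power_increasing power_mono prime_ge_1_nat zero_le)
    also have "\<dots> \<le> r ^ multiplicity r L"
      using \<open>n i \<le> multiplicity r L\<close> r prime_ge_1_nat by (intro power_increasing) auto
    finally show ?thesis .
  qed
  have stable: "d \<le> L ^ M" "gcd d (L ^ (N + M)) = gcd d (L ^ M)" if "1 \<le> d" "d \<le> q ^ M" for d M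
  proof -
    show "d \<le> L ^ M" using that(2) power_mono[OF qL, of M] by simp
    show "gcd d (L ^ (N + M)) = gcd d (L ^ M)"
      by (rule gcd_power_stable[OF that]) (use L2 q_le in simp_all)
  qed

  have "\<exists>M\<ge>1. d \<le> L ^ M \<and> gcd d (L ^ (N + M)) = gcd d (L ^ M)" if "1 \<le> d" for d
  proof -
    \<comment> \<open>\<open>M = d\<close> is a crude witness, enough for existence.\<close>
    have "d \<le> q ^ d" using power_gt_expt[of q d] q2 by simp
    then show ?thesis using stable[OF that] that by (intro exI[of _ d]) simp
  qed
  moreover
  have N: "sublist w (subst_power \<rho> N a)" if "legal \<rho> w" "length w = 2" for a w
    using LeastI_ex[OF legal_words_in_power[OF subst col0 prim, of 2], folded assms(9)] that by simp
  \<comment> \<open>Hence \<open>B\<close> is the logarithm of \<open>L\<close> to base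
    \<open>q\<close>, that is, \<open>q powr B = L\<close>.\<close>
  have lnq: "real (n 1) * ln (real (p 1)) = ln (real q)"
    using prime_gt_0_nat[OF p(1), of 1] t by (simp add: q_def ln_realpow)
  have bound: "ereal_of_enat (longest_monochromatic_ap v d)
      \<le> ereal (real L ^ (N + 1) * real d powr B)" if d: "1 \<le> d" for d
  proof -
    define M where "M = (LEAST M. d \<le> q ^ M)"
    have "d \<le> q ^ d" using power_gt_expt[of q d] q2 by simp
    then have M: "d \<le> q ^ M" unfolding M_def by (rule LeastI)
    have "longest_monochromatic_ap v d \<le> enat (L ^ (N + M))"
      unfolding longest_monochromatic_ap_def
      using monochromatic_ap_le[OF subst cl ap prim bij col0 comm fp N d stable[OF d M]]
      by (intro Sup_least) auto
    then have "ereal_of_enat (longest_monochromatic_ap v d) \<le> ereal_of_enat (enat (L ^ (N + M)))"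
      by (simp only: ereal_of_enat_le_iff)
    also have "\<dots> = ereal (real L ^ (N + M))" by simp
    also have "real L ^ (N + M) \<le> real L ^ (N + 1) * real d powr B"
    proof (cases M)
      \<comment> \<open>Here \<open>d = 1\<close>, and minimality of \<open>M\<close> gives nothing;
        the spare factor \<open>L\<close> in the bound suffices.\<close>
      case 0
      have "1 * 1 \<le> real L * real d powr B"
        using L2 d qL q2 unfolding assms(14) lnq
        by (intro mult_mono ge_one_powr_ge_zero) auto
      with 0 show ?thesis using L2 by (simp add: mult_left_mono)
    next
      case (Suc M')
      \<comment> \<open>Minimality of \<open>M\<close> bounds \<open>d\<close> from below. Raising
        to the power \<open>B\<close> turns \<open>q ^ M'\<close> into \<open>L ^ M'\<close>, and
        the remaining \<open>N + 1\<close> factors \<open>L\<close> form the constant.\<close>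
      then have "q ^ M' < d"
        using not_less_Least[of M' "\<lambda>M. d \<le> q ^ M"] by (simp add: M_def)
      then have "real q ^ M' \<le> real d" by (metis less_imp_le of_nat_le_iff of_nat_power)
      then have "(real q ^ M') powr B \<le> real d powr B"
        using L2 q2 unfolding assms(14) lnq by (intro powr_mono2) auto
      moreover have "(real q ^ M') powr B = real L ^ M'"
        using L2 q2 unfolding assms(14) lnq
        by (simp add: powr_def ln_realpow) (simp add: exp_of_nat2_mult)
      ultimately show ?thesis using Suc L2 by (simp add: power_add mult_left_mono)
    qed
    finally show ?thesis by simp
  qed
  moreover have "asymp_bounded (\<lambda>d. ereal_of_enat (longest_monochromatic_ap v d))
      (\<lambda>d. real L ^ (N + 1) * real d)" if "t = 1"
  proof -
    have "L = q" using that by (simp add: assms(11) q_def)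
    then have "B = 1" using q2 unfolding assms(14) lnq by simp
    show ?thesis
      unfolding asymp_bounded_def
    proof (intro exI conjI allI impI)
      fix d :: nat assume d: "1 \<le> d"
      then show "0 < real L ^ (N + 1) * real d" using L2 by simp
      show "ereal_of_enat (longest_monochromatic_ap v d) \<le> ereal (real L ^ (N + 1) * real d)"
        using bound[OF d] d \<open>B = 1\<close> by simp
    next
      \<comment> \<open>The bound itself serves as the witness \<open>h\<close>; the quotient is 1
        only for \<open>0 < d\<close>, as division by zero gives 0 at \<open>d = 0\<close>.\<close>
      have "\<forall>\<^sub>F d in sequentially. real L ^ (N + 1) * real d / (real L ^ (N + 1) * real d) = 1"
        using eventually_gt_at_top[of 0] by eventually_elim (use L2 in simp)
      then show "(\<lambda>d. real L ^ (N + 1) * real d / (real L ^ (N + 1) * real d)) \<longlonglongrightarrow> 1"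
        by (rule tendsto_eventually)
    qed
  qed
  ultimately show ?thesis by blast
qed

end
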